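(* In the Heisenberg group $\mathbb{H}^n$ one has $d_c=d_{\mathcal H}$.
   Context: The Heisenberg group $\mathbb{H}^n$ is $\mathbb{R}^{2n+1}$ with the group law $(x,y,t)(x',y',t')=(x+x',y+y',t+t'+\frac12(\langle x',y\rangle-\langle x,y'\rangle))$, where $x,x',y,y'\in\mathbb{R}^n$, $t,t'\in\mathbb{R}$. Its left-invariant vector fields $X_j=\frac{\partial}{\partial x_j}+\frac12y_j\frac{\partial}{\partial t}$, $X_{n+j}=\frac{\partial}{\partial y_j}-\frac12x_j\frac{\partial}{\partial t}$ ($j=1,\dots,n$) and $T=\frac{\partial}{\partial t}$ span its Lie algebra. The horizontal bundle is $\Sigma=\mathrm{span}\{X_1,\dots,X_{2n}\}$; $g$ is the Riemannian metric for which $X_1,\dots,X_{2n},T$ are orthonormal, and $g_c=g|_\Sigma$. Let $\nabla$ be the Levi-Civita connection of $g$ and $\mathcal P$ the $g$-orthogonal projection onto $\Sigma$. A piecewise smooth curve $\gamma$ is horizontal if $\dot\gamma(t)\in\Sigma_{\gamma(t)}$ for a.e. $t$; its length is $\ell(\gamma)=\int\sqrt{g_c(\dot\gamma,\dot\gamma)}\,dt$. A nonholonomic geodesic is a smooth horizontal curve with $D_{\dot\gamma}\dot\gamma:=\mathcal P(\nabla_{\dot\gamma}\dot\gamma)=0$. A broken geodesic is a continuous horizontal curve consisting of finitely many segments each of which is a nonholonomic geodesic. The Carnot-Carathéodory distance $d_c(p,q)$ is the infimum of lengths of horizontal curves joining $p$ to $q$, and $d_{\mathcal H}(p,q)$ is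 the infimum of lengths of broken geodesics joining $p$ to $q$. *)

theory Defs
  imports "HOL-Analysis.Analysis"
begin

section \<open>Smooth maps\<close>

primrec Ck :: "nat \<Rightarrow> ('a::euclidean_space \<Rightarrow> 'b::real_normed_vector) \<Rightarrow> bool" where
  "Ck 0 f \<longleftrightarrow> continuous_on UNIV f"
| "Ck (Suc k) f \<longleftrightarrow> (\<forall>x. f differentiable (at x)) \<and>
     (\<forall>v. Ck k (\<lambda>x. frechet_derivative f (at x) v))"

definition smooth_map :: "('a::euclidean_space \<Rightarrow> 'b::real_normed_vector) \<Rightarrow> bool" where
  "smooth_map f \<longleftrightarrow> (\<forall>k. Ck k f)"

definition smooth_curve :: "real \<Rightarrow> real \<Rightarrow> (real \<Rightarrow> 'a::euclidean_space) \<Rightarrow> bool" where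
  "smooth_curve a b \<gamma> \<longleftrightarrow> (\<exists>c. smooth_map c \<and> (\<forall>t\<in>{a..b}. \<gamma> t = c t))"

text \<open>The velocity is one-sided at the end points; at a break point of a piecewise smooth
  curve (where it may be undefined) its value is arbitrary.\<close>

definition velocity :: "real \<Rightarrow> real \<Rightarrow> (real \<Rightarrow> 'a::real_normed_vector) \<Rightarrow> real \<Rightarrow> 'a" where
  "velocity a b \<gamma> t = vector_derivative \<gamma> (at t within {a..b})"

definition piecewise :: "(real \<Rightarrow> real \<Rightarrow> bool) \<Rightarrow> real \<Rightarrow> real \<Rightarrow> bool" where
  "piecewise Q a b \<longleftrightarrow> (\<exists>(m::nat) s. s 0 = a \<and> s m = b \<and>
     (\<forall>i<m. s i < s (Suc i) \<and> Q (s i) (s (Suc i))))"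

definition piecewise_smooth_curve :: "real \<Rightarrow> real \<Rightarrow> (real \<Rightarrow> 'a::euclidean_space) \<Rightarrow> bool" where
  "piecewise_smooth_curve a b \<gamma> \<longleftrightarrow> a < b \<and> continuous_on {a..b} \<gamma> \<and>
     piecewise (\<lambda>c d. smooth_curve c d \<gamma>) a b"

section \<open>The Levi-Civita connection of a metric on a Euclidean space\<close>

text \<open>Vector fields on the manifold \<^typ>\<open>'a\<close> are maps \<^typ>\<open>'a \<Rightarrow> 'a\<close>, all tangent spaces being
  identified with \<^typ>\<open>'a\<close>; a metric assigns to each point a bilinear form.\<close>

definition lie_derivative ::
    "('a::euclidean_space \<Rightarrow> 'a) \<Rightarrow> ('a \<Rightarrow> 'b::real_normed_vector) \<Rightarrow> 'a \<Rightarrow> 'b" where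
  "lie_derivative X f p = frechet_derivative f (at p) (X p)"

definition lie_bracket :: "('a::euclidean_space \<Rightarrow> 'a) \<Rightarrow> ('a \<Rightarrow> 'a) \<Rightarrow> 'a \<Rightarrow> 'a" where
  "lie_bracket X Y p = lie_derivative X Y p - lie_derivative Y X p"

definition affine_connection ::
    "(('a::euclidean_space \<Rightarrow> 'a) \<Rightarrow> ('a \<Rightarrow> 'a) \<Rightarrow> 'a \<Rightarrow> 'a) \<Rightarrow> bool" where
  "affine_connection N \<longleftrightarrow>
     (\<forall>X Y. smooth_map X \<and> smooth_map Y \<longrightarrow> smooth_map (N X Y)) \<and>
     (\<forall>X X' Y. smooth_map X \<and> smooth_map X' \<and> smooth_map Y \<longrightarrow>
        (\<forall>p. N (\<lambda>q. X q + X' q) Y p = N X Y p + N X' Y p)) \<and>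
     (\<forall>X Y Y'. smooth_map X \<and> smooth_map Y \<and> smooth_map Y' \<longrightarrow>
        (\<forall>p. N X (\<lambda>q. Y q + Y' q) p = N X Y p + N X Y' p)) \<and>
     (\<forall>(f::'a \<Rightarrow> real) X Y. smooth_map f \<and> smooth_map X \<and> smooth_map Y \<longrightarrow>
        (\<forall>p. N (\<lambda>q. f q *\<^sub>R X q) Y p = f p *\<^sub>R N X Y p)) \<and>
     (\<forall>(f::'a \<Rightarrow> real) X Y. smooth_map f \<and> smooth_map X \<and> smooth_map Y \<longrightarrow>
        (\<forall>p. N X (\<lambda>q. f q *\<^sub>R Y q) p = lie_derivative X f p *\<^sub>R Y p + f p *\<^sub>R N X Y p))"

definition torsion_free ::
    "(('a::euclidean_space \<Rightarrow> 'a) \<Rightarrow> ('a \<Rightarrow> 'a) \<Rightarrow> 'a \<Rightarrow> 'a) \<Rightarrow> bool" where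
  "torsion_free N \<longleftrightarrow> (\<forall>X Y. smooth_map X \<and> smooth_map Y \<longrightarrow>
     (\<forall>p. N X Y p - N Y X p = lie_bracket X Y p))"

definition metric_compatible :: "('a::euclidean_space \<Rightarrow> 'a \<Rightarrow> 'a \<Rightarrow> real) \<Rightarrow>
    (('a \<Rightarrow> 'a) \<Rightarrow> ('a \<Rightarrow> 'a) \<Rightarrow> 'a \<Rightarrow> 'a) \<Rightarrow> bool" where
  "metric_compatible g N \<longleftrightarrow> (\<forall>X Y Z. smooth_map X \<and> smooth_map Y \<and> smooth_map Z \<longrightarrow>
     (\<forall>p. lie_derivative X (\<lambda>q. g q (Y q) (Z q)) p =
            g p (N X Y p) (Z p) + g p (Y p) (N X Z p)))"

text \<open>A connection is only meaningful on smooth vector fields. The last clause fixes its value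
  on all other arguments, so that there is exactly one Levi-Civita connection as a function.\<close>

definition is_levi_civita :: "('a::euclidean_space \<Rightarrow> 'a \<Rightarrow> 'a \<Rightarrow> real) \<Rightarrow>
    (('a \<Rightarrow> 'a) \<Rightarrow> ('a \<Rightarrow> 'a) \<Rightarrow> 'a \<Rightarrow> 'a) \<Rightarrow> bool" where
  "is_levi_civita g N \<longleftrightarrow> affine_connection N \<and> torsion_free N \<and> metric_compatible g N \<and>
     (\<forall>X Y. \<not> (smooth_map X \<and> smooth_map Y) \<longrightarrow> N X Y = (\<lambda>p. 0))"

definition levi_civita :: "('a::euclidean_space \<Rightarrow> 'a \<Rightarrow> 'a \<Rightarrow> real) \<Rightarrow>
    ('a \<Rightarrow> 'a) \<Rightarrow> ('a \<Rightarrow> 'a) \<Rightarrow> 'a \<Rightarrow> 'a" where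
  "levi_civita g = (THE N. is_levi_civita g N)"

text \<open>Covariant derivative along \<open>\<gamma>\<close> of a vector field \<open>V\<close> along \<open>\<gamma>\<close>. Expanding \<open>V\<close> in the
  coordinate fields, which are the constant maps, the Leibniz rule gives the derivative of the
  coefficients of \<open>V\<close> plus the Christoffel term, i.e. the connection applied to constant fields.\<close>

definition covariant_derivative_along :: "(('a::euclidean_space \<Rightarrow> 'a) \<Rightarrow> ('a \<Rightarrow> 'a) \<Rightarrow> 'a \<Rightarrow> 'a) \<Rightarrow>
    real \<Rightarrow> real \<Rightarrow> (real \<Rightarrow> 'a) \<Rightarrow> (real \<Rightarrow> 'a) \<Rightarrow> real \<Rightarrow> 'a" where
  "covariant_derivative_along N a b \<gamma> V t =
     vector_derivative V (at t within {a..b}) + N (\<lambda>_. velocity a b \<gamma> t) (\<lambda>_. V t) (\<gamma> t)"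

section \<open>The Heisenberg group\<close>

type_synonym 'n heis = "(real^'n) \<times> (real^'n) \<times> real"

fun heis_mult :: "'n::finite heis \<Rightarrow> 'n heis \<Rightarrow> 'n heis" where
  "heis_mult (x, y, t) (x', y', t') = (x + x', y + y', t + t' + (x' \<bullet> y - x \<bullet> y') / 2)"

text \<open>\<open>heis_X j\<close>, \<open>heis_Y j\<close> are the fields usually numbered \<open>j\<close> and \<open>n + j\<close>.\<close>

fun heis_X :: "'n::finite \<Rightarrow> 'n heis \<Rightarrow> 'n heis" where
  "heis_X j (x, y, t) = (axis j 1, 0, (y $ j) / 2)"

fun heis_Y :: "'n::finite \<Rightarrow> 'n heis \<Rightarrow> 'n heis" where
  "heis_Y j (x, y, t) = (0, axis j 1, - (x $ j) / 2)"

definition heis_T :: "'n::finite heis \<Rightarrow> 'n heis" where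
  "heis_T p = (0, 0, 1)"

text \<open>The frame fields are left-invariant.\<close>

lemma heis_frame_left_invariant:
  fixes p q :: "'n::finite heis"
  shows "(heis_mult p has_derivative (\<lambda>(a, b, c). (a, b, c + (a \<bullet> fst (snd p) - fst p \<bullet> b) / 2))) (at q)"
    and "(case heis_X j q of (a, b, c) \<Rightarrow> (a, b, c + (a \<bullet> fst (snd p) - fst p \<bullet> b) / 2)) = heis_X j (heis_mult p q)"
    and "(case heis_Y j q of (a, b, c) \<Rightarrow> (a, b, c + (a \<bullet> fst (snd p) - fst p \<bullet> b) / 2)) = heis_Y j (heis_mult p q)"
    and "(case heis_T q of (a, b, c) \<Rightarrow> (a, b, c + (a \<bullet> fst (snd p) - fst p \<bullet> b) / 2)) = heis_T (heis_mult p q)"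
proof -
  obtain x y t where p: "p = (x, y, t)" by (cases p) auto
  have m: "heis_mult p = (\<lambda>q. (x + fst q, y + fst (snd q), t + snd (snd q) + (fst q \<bullet> y - x \<bullet> fst (snd q)) / 2))"
    by (auto simp: p)
  show "(heis_mult p has_derivative (\<lambda>(a, b, c). (a, b, c + (a \<bullet> fst (snd p) - fst p \<bullet> b) / 2))) (at q)"
    unfolding m by (auto intro!: derivative_eq_intros simp: p case_prod_beta inner_commute)
qed (cases p; cases q; auto simp: heis_T_def inner_axis inner_axis' field_simps)+

definition heis_frame :: "'n::finite heis \<Rightarrow> 'n heis set" where
  "heis_frame p = range (\<lambda>j. heis_X j p) \<union> range (\<lambda>j. heis_Y j p) \<union> {heis_T p}"

definition horizontal_space :: "'n::finite heis \<Rightarrow> 'n heis set" where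
  "horizontal_space p = span (range (\<lambda>j. heis_X j p) \<union> range (\<lambda>j. heis_Y j p))"

definition heis_metric :: "'n::finite heis \<Rightarrow> 'n heis \<Rightarrow> 'n heis \<Rightarrow> real" where
  "heis_metric p = (THE G. bilinear G \<and>
     (\<forall>u\<in>heis_frame p. \<forall>v\<in>heis_frame p. G u v = (if u = v then 1 else 0)))"

definition horizontal_proj :: "'n::finite heis \<Rightarrow> 'n heis \<Rightarrow> 'n heis" where
  "horizontal_proj p v =
     (THE w. w \<in> horizontal_space p \<and> (\<forall>u\<in>horizontal_space p. heis_metric p (v - w) u = 0))"

section \<open>Horizontal curves, nonholonomic geodesics and the two distances\<close>

definition horizontal_curve :: "real \<Rightarrow> real \<Rightarrow> (real \<Rightarrow> 'n::finite heis) \<Rightarrow> bool" where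
  "horizontal_curve a b \<gamma> \<longleftrightarrow> piecewise_smooth_curve a b \<gamma> \<and>
     (AE t in lebesgue_on {a..b}. velocity a b \<gamma> t \<in> horizontal_space (\<gamma> t))"

text \<open>For horizontal curves, \<open>heis_metric\<close> is only evaluated on horizontal vectors (almost
  everywhere), where it is the sub-Riemannian metric.\<close>

definition heis_length :: "real \<Rightarrow> real \<Rightarrow> (real \<Rightarrow> 'n::finite heis) \<Rightarrow> real" where
  "heis_length a b \<gamma> =
     integral {a..b} (\<lambda>t. sqrt (heis_metric (\<gamma> t) (velocity a b \<gamma> t) (velocity a b \<gamma> t)))"

definition nonholonomic_geodesic :: "real \<Rightarrow> real \<Rightarrow> (real \<Rightarrow> 'n::finite heis) \<Rightarrow> bool" where
  "nonholonomic_geodesic a b \<gamma> \<longleftrightarrow> smooth_curve a b \<gamma> \<and> horizontal_curve a b \<gamma> \<and>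
     (\<forall>t\<in>{a..b}. horizontal_proj (\<gamma> t)
        (covariant_derivative_along (levi_civita heis_metric) a b \<gamma> (velocity a b \<gamma>) t) = 0)"

definition broken_geodesic :: "real \<Rightarrow> real \<Rightarrow> (real \<Rightarrow> 'n::finite heis) \<Rightarrow> bool" where
  "broken_geodesic a b \<gamma> \<longleftrightarrow> horizontal_curve a b \<gamma> \<and>
     piecewise (\<lambda>c d. nonholonomic_geodesic c d \<gamma>) a b"

text \<open>The infima are taken in the extended reals, so that an empty infimum would be \<open>\<infinity>\<close>.\<close>

definition heis_dc :: "'n::finite heis \<Rightarrow> 'n heis \<Rightarrow> ereal" where
  "heis_dc p q =
     Inf {ereal (heis_length a b \<gamma>) | a b \<gamma>. horizontal_curve a b \<gamma> \<and> \<gamma> a = p \<and> \<gamma> b = q}"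

definition heis_dH :: "'n::finite heis \<Rightarrow> 'n heis \<Rightarrow> ereal" where
  "heis_dH p q =
     Inf {ereal (heis_length a b \<gamma>) | a b \<gamma>. broken_geodesic a b \<gamma> \<and> \<gamma> a = p \<and> \<gamma> b = q}"

section \<open>Well-definedness of the definite descriptions above\<close>

text \<open>The left-invariant contact form: it vanishes on the horizontal fields and is \<open>1\<close> on
  \<open>heis_T\<close>.\<close>

fun heis_form :: "'n::finite heis \<Rightarrow> 'n heis \<Rightarrow> real" where
  "heis_form (x, y, t) (a, b, c) = c - (a \<bullet> y) / 2 + (x \<bullet> b) / 2"

lemma heis_form_alt: "heis_form p u = snd (snd u) - (fst u \<bullet> fst (snd p)) / 2 + (fst p \<bullet> fst (snd u)) / 2"
  by (cases p; cases u) auto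

lemma frame_expansion:
  fixes p v :: "'n::finite heis"
  shows "v = (\<Sum>j\<in>UNIV. (fst v $ j) *\<^sub>R heis_X j p) + (\<Sum>j\<in>UNIV. (fst (snd v) $ j) *\<^sub>R heis_Y j p)
     + heis_form p v *\<^sub>R heis_T p"
proof -
  obtain x y t where p: "p = (x, y, t)" by (cases p) auto
  obtain a b c where v: "v = (a, b, c)" by (cases v) auto
  have A: "(\<Sum>j\<in>UNIV. (a $ j) *\<^sub>R axis j 1) = a" for a :: "real^'n"
    using basis_expansion[of a] by (simp add: scalar_mult_eq_scaleR)
  have B: "(\<Sum>j\<in>UNIV. (a $ j) * ((x $ j) / 2)) = (a \<bullet> x) / 2" for a x :: "real^'n"
    by (simp add: inner_vec_def sum_divide_distrib)
  have C: "(\<Sum>j\<in>UNIV. (fst v $ j) *\<^sub>R heis_X j p) = (a, 0, (a \<bullet> y) / 2)"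
    by (auto simp: v p prod_eq_iff fst_sum snd_sum A B[symmetric])
  have D: "(\<Sum>j\<in>UNIV. (fst (snd v) $ j) *\<^sub>R heis_Y j p) = (0, b, - (b \<bullet> x) / 2)"
    using B[of b x] by (auto simp: v p prod_eq_iff fst_sum snd_sum A sum_negf)
  show ?thesis unfolding C D by (auto simp: v p heis_T_def inner_commute)
qed

lemma span_heis_frame: "span (heis_frame p) = UNIV"
proof -
  have "v \<in> span (heis_frame p)" for v
    by (subst frame_expansion[of v p], intro span_add span_sum span_scale span_base)
      (auto simp: heis_frame_def)
  then show ?thesis by auto
qed

lemma axis_nth_real: "axis i (1::real) $ j = (if i = j then 1 else 0)"
  by (simp add: axis_def)

lemma bilinear_heis_metric_explicit:
  "bilinear (\<lambda>u v. fst u \<bullet> fst v + fst (snd u) \<bullet> fst (snd v) + heis_form p u * heis_form p v)"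
  by (auto simp: bilinear_def heis_form_alt algebra_simps add_divide_distrib intro!: linearI)

lemma heis_metric_eq:
  fixes p :: "'a::finite heis"
  shows "heis_metric p u v = fst u \<bullet> fst v + fst (snd u) \<bullet> fst (snd v) + heis_form p u * heis_form p v"
proof -
  let ?G = "\<lambda>u v. fst u \<bullet> fst v + fst (snd u) \<bullet> fst (snd v) + heis_form p u * heis_form p v"
  have on: "\<forall>u\<in>heis_frame p. \<forall>v\<in>heis_frame p. ?G u v = (if u = v then 1 else 0)"
    by (cases p) (auto simp: heis_frame_def heis_T_def inner_axis inner_axis' axis_eq_axis axis_nth_real split: if_splits)
  have "heis_metric p = ?G"
    unfolding heis_metric_def
  proof (rule the_equality)
    show "bilinear ?G \<and> (\<forall>u\<in>heis_frame p. \<forall>v\<in>heis_frame p. ?G u v = (if u = v then 1 else 0))"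
      using on bilinear_heis_metric_explicit by blast
  next
    fix G :: "'a heis \<Rightarrow> 'a heis \<Rightarrow> real"
    assume G: "bilinear G \<and> (\<forall>u\<in>heis_frame p. \<forall>v\<in>heis_frame p. G u v = (if u = v then 1 else 0))"
    show "G = ?G"
    proof (intro ext)
      fix u v
      show "G u v = ?G u v"
        by (rule bilinear_eq[of G ?G UNIV "heis_frame p" UNIV "heis_frame p"])
          (use G on bilinear_heis_metric_explicit[of p] in \<open>auto simp: span_heis_frame\<close>)
    qed
  qed
  then show ?thesis by simp
qed

lemma horizontal_space_iff: "v \<in> horizontal_space p \<longleftrightarrow> heis_form p v = 0"
proof
  assume "v \<in> horizontal_space p"
  then show "heis_form p v = 0"
    unfolding horizontal_space_def
  proof (induction rule: span_induct_alt)
    case base then show ?case by (cases p) (auto simp: heis_form_alt)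
  next
    case (step c x y)
    then show ?case by (cases p) (auto simp: heis_form_alt inner_axis inner_axis' algebra_simps add_divide_distrib)
  qed
next
  assume "heis_form p v = 0"
  then show "v \<in> horizontal_space p"
    unfolding horizontal_space_def
    apply (subst frame_expansion[of v p])
    apply simp
    apply (intro span_add span_sum span_scale span_base)
    apply auto
    done
qed

lemma heis_metric_nondegenerate: "(\<And>w. heis_metric p u w = 0) \<Longrightarrow> u = 0"
proof -
  assume "\<And>w. heis_metric p u w = 0"
  then have "heis_metric p u u = 0" .
  then have "fst u \<bullet> fst u = 0 \<and> fst (snd u) \<bullet> fst (snd u) = 0 \<and> heis_form p u * heis_form p u = 0"
    unfolding heis_metric_eq
    by (smt (verit) inner_ge_zero zero_le_square)
  then show "u = 0" by (auto simp: heis_form_alt prod_eq_iff)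
qed

lemma Ck_mono: "Ck (Suc k) f \<Longrightarrow> Ck k f"
proof (induction k arbitrary: f)
  case 0 then show ?case
    by (auto simp: continuous_on_eq_continuous_at differentiable_imp_continuous_within)
next
  case (Suc k)
  then show ?case by (metis Ck.simps(2))
qed

lemma Ck_const: "Ck k (\<lambda>x. c)"
  by (induction k arbitrary: c) (auto simp: frechet_derivative_const)

lemma Ck_linear: assumes "bounded_linear f" shows "Ck k f"
proof (cases k)
  case 0 then show ?thesis using assms by (simp add: linear_continuous_on)
next
  case (Suc m)
  have "(f has_derivative f) (at x)" for x using assms by (rule bounded_linear_imp_has_derivative)
  then have "frechet_derivative f (at x) = f" "f differentiable (at x)" for x
    by (metis frechet_derivative_at) (metis \<open>\<And>x. (f has_derivative f) (at x)\<close> differentiableI)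
  then show ?thesis using Suc by (simp add: Ck_const)
qed

lemma Ck_add: "Ck k f \<Longrightarrow> Ck k g \<Longrightarrow> Ck k (\<lambda>x. f x + g x)"
proof (induction k arbitrary: f g)
  case (Suc k)
  have "frechet_derivative (\<lambda>x. f x + g x) (at x) = (\<lambda>v. frechet_derivative f (at x) v + frechet_derivative g (at x) v)" for x
    using Suc.prems by (intro frechet_derivative_at[symmetric]) (auto intro!: derivative_intros simp: frechet_derivative_works[symmetric])
  then show ?case using Suc by (auto)
qed (auto intro: continuous_intros)

lemma Ck_bilin:
  assumes B: "bounded_bilinear B"
  shows "Ck k f \<Longrightarrow> Ck k g \<Longrightarrow> Ck k (\<lambda>x. B (f x) (g x))"
proof (induction k arbitrary: f g)
  case 0 then show ?case using bounded_bilinear.continuous_on[OF B] by auto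
next
  case (Suc k)
  have D: "((\<lambda>x. B (f x) (g x)) has_derivative (\<lambda>v. B (f x) (frechet_derivative g (at x) v) + B (frechet_derivative f (at x) v) (g x))) (at x)" for x
    using Suc.prems by (intro bounded_bilinear.FDERIV[OF B]) (auto simp: frechet_derivative_works[symmetric])
  then have E: "frechet_derivative (\<lambda>x. B (f x) (g x)) (at x) = (\<lambda>v. B (f x) (frechet_derivative g (at x) v) + B (frechet_derivative f (at x) v) (g x))" for x
    by (rule frechet_derivative_at[symmetric])
  show ?case
    using Suc D by (auto simp: E intro!: Ck_add Suc.IH Ck_mono[of k f] Ck_mono[of k g] intro: differentiableI simp del: Ck.simps(2)
      simp: Ck.simps(2)[of k "\<lambda>x. B (f x) (g x)"]) (auto)
qed

lemma smooth_const [intro]: "smooth_map (\<lambda>x. c)" by (auto simp: smooth_map_def Ck_const)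
lemma smooth_linear: "bounded_linear f \<Longrightarrow> smooth_map f" by (auto simp: smooth_map_def Ck_linear)
lemma smooth_add: "smooth_map f \<Longrightarrow> smooth_map g \<Longrightarrow> smooth_map (\<lambda>x. f x + g x)" by (auto simp: smooth_map_def Ck_add)
lemma smooth_bilin: "bounded_bilinear B \<Longrightarrow> smooth_map f \<Longrightarrow> smooth_map g \<Longrightarrow> smooth_map (\<lambda>x. B (f x) (g x))"
  by (auto simp: smooth_map_def Ck_bilin)
lemma smooth_sum: "(\<And>i. i \<in> A \<Longrightarrow> smooth_map (f i)) \<Longrightarrow> smooth_map (\<lambda>x. \<Sum>i\<in>A. f i x)"
  by (induction A rule: infinite_finite_induct) (auto intro!: smooth_add)
lemmas smooth_scaleR = smooth_bilin[OF bounded_bilinear_scaleR]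
lemmas smooth_mult = smooth_bilin[OF bounded_bilinear_mult]
lemmas smooth_inner = smooth_bilin[OF bounded_bilinear_inner]
lemma smooth_lin_comp: 
  assumes "bounded_linear L" "smooth_map f" shows "smooth_map (\<lambda>x. L (f x))"
proof -
  have "bounded_bilinear (\<lambda>r x. r *\<^sub>R L x)"
    using bounded_bilinear.comp[OF bounded_bilinear_scaleR bounded_linear_ident assms(1)] .
  from smooth_bilin[OF this smooth_const[of 1] assms(2)] show ?thesis by simp
qed
lemma smooth_fst: "smooth_map f \<Longrightarrow> smooth_map (\<lambda>x. fst (f x))" by (rule smooth_lin_comp[OF bounded_linear_fst])
lemma smooth_snd: "smooth_map f \<Longrightarrow> smooth_map (\<lambda>x. snd (f x))" by (rule smooth_lin_comp[OF bounded_linear_snd])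
lemma smooth_id: "smooth_map (\<lambda>x. x)" by (rule smooth_linear) (rule bounded_linear_ident)
lemma smooth_Pair: "smooth_map f \<Longrightarrow> smooth_map g \<Longrightarrow> smooth_map (\<lambda>x. (f x, g x))"
proof -
  assume a: "smooth_map f" "smooth_map g"
  have "bounded_linear (\<lambda>x. (x, 0))" "bounded_linear (\<lambda>x. (0, x))"
    by (auto intro!: bounded_linear_Pair bounded_linear_ident bounded_linear_zero)
  from smooth_add[OF smooth_lin_comp[OF this(1) a(1)] smooth_lin_comp[OF this(2) a(2)]]
  show ?thesis by simp
qed
lemma smooth_uminus: "smooth_map f \<Longrightarrow> smooth_map (\<lambda>x. - f x)"
  using smooth_lin_comp[OF bounded_linear_minus[OF bounded_linear_ident]] .
lemma smooth_diff: "smooth_map f \<Longrightarrow> smooth_map g \<Longrightarrow> smooth_map (\<lambda>x. f x - g x)"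
  using smooth_add[OF _ smooth_uminus, of f g] by simp
lemma smooth_differentiable: "smooth_map f \<Longrightarrow> (f has_derivative frechet_derivative f (at x)) (at x)"
  unfolding smooth_map_def by (metis Ck.simps(2) frechet_derivative_works)
lemma smooth_dir: "smooth_map f \<Longrightarrow> smooth_map (\<lambda>x. frechet_derivative f (at x) v)"
  unfolding smooth_map_def by (metis Ck.simps(2))

lemma smooth_lie_derivative:
  assumes "smooth_map X" "smooth_map f" shows "smooth_map (lie_derivative X f)"
proof -
  have "lie_derivative X f p = (\<Sum>b\<in>Basis. (X p \<bullet> b) *\<^sub>R frechet_derivative f (at p) b)" for p
  proof -
    have l: "linear (frechet_derivative f (at p))" using smooth_differentiable[OF assms(2)] has_derivative_linear by blast
    show ?thesis unfolding lie_derivative_def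
      by (subst euclidean_representation[of "X p", symmetric]) (simp add: linear_sum[OF l] linear_scale[OF l])
  qed
  then have e: "lie_derivative X f = (\<lambda>p. \<Sum>b\<in>Basis. (X p \<bullet> b) *\<^sub>R frechet_derivative f (at p) b)" by auto
  show ?thesis unfolding e by (intro smooth_sum smooth_scaleR smooth_inner smooth_dir assms smooth_const)
qed

lemma is_levi_civita_koszul:
  assumes "is_levi_civita g N" and sym: "\<And>p u v. g p u v = g p v u" and lin: "\<And>p. bilinear (g p)"
    and s: "smooth_map X" "smooth_map Y" "smooth_map Z"
  shows "2 * g p (N X Y p) (Z p) = lie_derivative X (\<lambda>q. g q (Y q) (Z q)) p
     + lie_derivative Y (\<lambda>q. g q (X q) (Z q)) p - lie_derivative Z (\<lambda>q. g q (X q) (Y q)) p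
     + g p (lie_bracket X Y p) (Z p) - g p (lie_bracket X Z p) (Y p) - g p (lie_bracket Y Z p) (X p)"
proof -
  have T: "lie_bracket A B p = N A B p - N B A p" if "smooth_map A" "smooth_map B" for A B
    using assms(1) that unfolding is_levi_civita_def torsion_free_def by metis
  have M: "lie_derivative A (\<lambda>q. g q (B q) (C q)) p = g p (N A B p) (C p) + g p (B p) (N A C p)"
    if "smooth_map A" "smooth_map B" "smooth_map C" for A B C
    using assms(1) that unfolding is_levi_civita_def metric_compatible_def by metis
  show ?thesis
    using s by (simp add: T M bilinear_lsub[OF lin] sym[of p "X p"] sym[of p "Y p"])
qed

text \<open>The explicit Levi-Civita connection, obtained by evaluating Koszul's formula on constant fields.\<close>

definition heis_christoffel :: "'n::finite heis \<Rightarrow> 'n heis \<Rightarrow> 'n heis \<Rightarrow> 'n heis" where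
  "heis_christoffel p u v = (let a = - (heis_form p v / 2) *\<^sub>R fst (snd u) - (heis_form p u / 2) *\<^sub>R fst (snd v);
                    b = (heis_form p v / 2) *\<^sub>R fst u + (heis_form p u / 2) *\<^sub>R fst v
     in (a, b, (a \<bullet> fst (snd p)) / 2 - (fst p \<bullet> b) / 2))"

lemma smooth_form: "smooth_map X \<Longrightarrow> smooth_map (\<lambda>p. heis_form p (X p))"
proof -
  assume s: "smooth_map X"
  have e: "heis_form p (X p) = snd (snd (X p)) - (1/2) * (fst (X p) \<bullet> fst (snd p)) + (1/2) * (fst p \<bullet> fst (snd (X p)))" for p
    by (simp add: heis_form_alt)
  show ?thesis unfolding e
    by (intro smooth_add smooth_diff smooth_mult smooth_inner smooth_fst smooth_snd smooth_const s smooth_id)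
qed

lemma smooth_heis_christoffel:
  assumes "smooth_map X" "smooth_map Y" shows "smooth_map (\<lambda>p. heis_christoffel p (X p) (Y p))"
proof -
  have h: "smooth_map f \<Longrightarrow> smooth_map (\<lambda>p. f p / 2 :: real)" for f :: "'n::finite heis \<Rightarrow> real"
    by (rule smooth_lin_comp[OF bounded_linear_divide])
  show ?thesis unfolding heis_christoffel_def Let_def
    by (intro smooth_Pair smooth_add smooth_diff smooth_scaleR smooth_inner smooth_fst smooth_snd h smooth_uminus smooth_form assms smooth_id)
qed

definition heis_connection :: "('n::finite heis \<Rightarrow> 'n heis) \<Rightarrow> ('n heis \<Rightarrow> 'n heis) \<Rightarrow> 'n heis \<Rightarrow> 'n heis" where
  "heis_connection X Y = (if smooth_map X \<and> smooth_map Y then (\<lambda>p. lie_derivative X Y p + heis_christoffel p (X p) (Y p)) else (\<lambda>p. 0))"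

lemma heis_christoffel_linear:
  "heis_christoffel p (u + u') v = heis_christoffel p u v + heis_christoffel p u' v" "heis_christoffel p u (v + v') = heis_christoffel p u v + heis_christoffel p u v'"
  "heis_christoffel p (c *\<^sub>R u) v = c *\<^sub>R heis_christoffel p u v" "heis_christoffel p u (c *\<^sub>R v) = c *\<^sub>R heis_christoffel p u v" "heis_christoffel p u v = heis_christoffel p v u"
  by (auto simp: heis_christoffel_def Let_def heis_form_alt algebra_simps add_divide_distrib diff_divide_distrib)

lemma metric_heis_connection:
  assumes s: "smooth_map X" "smooth_map Y" "smooth_map Z"
  shows "lie_derivative X (\<lambda>q. heis_metric q (Y q) (Z q)) p =
            heis_metric p (heis_connection X Y p) (Z p) + heis_metric p (Y p) (heis_connection X Z p)"
proof -
  define Y' Z' where "Y' = frechet_derivative Y (at p)" and "Z' = frechet_derivative Z (at p)"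
  have Y: "(Y has_derivative Y') (at p)" and Z: "(Z has_derivative Z') (at p)"
    using s smooth_differentiable unfolding Y'_def Z'_def by blast+
  note [derivative_intros] = Y Z
  have F: "((\<lambda>q. heis_metric q (Y q) (Z q)) has_derivative (\<lambda>h.
     fst (Y' h) \<bullet> fst (Z p) + fst (Y p) \<bullet> fst (Z' h) + fst (snd (Y' h)) \<bullet> fst (snd (Z p)) + fst (snd (Y p)) \<bullet> fst (snd (Z' h))
     + (heis_form p (Y' h) - fst (Y p) \<bullet> fst (snd h) / 2 + fst h \<bullet> fst (snd (Y p)) / 2) * heis_form p (Z p)
     + heis_form p (Y p) * (heis_form p (Z' h) - fst (Z p) \<bullet> fst (snd h) / 2 + fst h \<bullet> fst (snd (Z p)) / 2))) (at p)"
    unfolding heis_metric_eq heis_form_alt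
    by (rule derivative_eq_intros refl | simp add: fun_eq_iff algebra_simps add_divide_distrib diff_divide_distrib)+
  have L: "lie_derivative X Y p = Y' (X p)" "lie_derivative X Z p = Z' (X p)"
    by (auto simp: lie_derivative_def Y'_def Z'_def)
  have hG: "heis_form p (heis_christoffel p u v) = 0" for u v
    by (simp add: heis_christoffel_def Let_def heis_form_alt inner_commute)
  have ha: "heis_form p (u + v) = heis_form p u + heis_form p v" for u v
    by (simp add: heis_form_alt algebra_simps add_divide_distrib)
  show ?thesis
    using s unfolding lie_derivative_def[of X "\<lambda>q. heis_metric q (Y q) (Z q)"] frechet_derivative_at[OF F, symmetric]
    unfolding heis_metric_eq
    apply (simp add: heis_connection_def L ha hG inner_add_left inner_add_right)
    apply (simp add: heis_christoffel_def Let_def inner_commute algebra_simps)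
    done
qed

lemma is_levi_civita_heis_connection: "is_levi_civita (heis_metric :: 'n::finite heis \<Rightarrow> _) heis_connection"
  unfolding is_levi_civita_def
proof (intro conjI)
  have d: "(f has_derivative frechet_derivative f (at p)) (at p)" if "smooth_map f" for f :: "'n heis \<Rightarrow> 'n heis" and p
    using that by (rule smooth_differentiable)
  show "affine_connection (heis_connection :: ('n heis \<Rightarrow> _) \<Rightarrow> _)"
    unfolding affine_connection_def
  proof (intro conjI allI impI; (elim conjE)?)
    fix X Y :: "'n heis \<Rightarrow> 'n heis" assume "smooth_map X" "smooth_map Y"
    then show "smooth_map (heis_connection X Y)" unfolding heis_connection_def by (simp add: smooth_add smooth_lie_derivative smooth_heis_christoffel)
  next
    fix X X' Y :: "'n heis \<Rightarrow> 'n heis" and p assume s: "smooth_map X" "smooth_map Y" "smooth_map X'"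
    have l: "linear (frechet_derivative Y (at p))" using d[OF s(2)] has_derivative_linear by blast
    show "heis_connection (\<lambda>q. X q + X' q) Y p = heis_connection X Y p + heis_connection X' Y p"
      using s by (simp add: heis_connection_def smooth_add heis_christoffel_linear lie_derivative_def linear_add[OF l])
  next
    fix X Y Y' :: "'n heis \<Rightarrow> 'n heis" and p assume s: "smooth_map X" "smooth_map Y" "smooth_map Y'"
    show "heis_connection X (\<lambda>q. Y q + Y' q) p = heis_connection X Y p + heis_connection X Y' p"
      using s frechet_derivative_at[OF has_derivative_add[OF d[OF s(2)] d[OF s(3)]], symmetric]
      by (simp add: heis_connection_def smooth_add heis_christoffel_linear(2) lie_derivative_def)
  next
    fix f :: "'n heis \<Rightarrow> real" and X Y :: "'n heis \<Rightarrow> 'n heis" and p assume s: "smooth_map f" "smooth_map X" "smooth_map Y"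
    have l: "linear (frechet_derivative Y (at p))" using d[OF s(3)] has_derivative_linear by blast
    show "heis_connection (\<lambda>q. f q *\<^sub>R X q) Y p = f p *\<^sub>R heis_connection X Y p"
      using s by (simp add: heis_connection_def smooth_scaleR heis_christoffel_linear lie_derivative_def linear_scale[OF l] scaleR_add_right)
    show "heis_connection X (\<lambda>q. f q *\<^sub>R Y q) p = lie_derivative X f p *\<^sub>R Y p + f p *\<^sub>R heis_connection X Y p"
      using s frechet_derivative_at[OF has_derivative_scaleR[OF smooth_differentiable[OF s(1)] d[OF s(3)]], symmetric]
      by (simp add: heis_connection_def smooth_scaleR heis_christoffel_linear(4) lie_derivative_def scaleR_add_right)
  qed
  show "torsion_free (heis_connection :: ('n heis \<Rightarrow> _) \<Rightarrow> _)"
    unfolding torsion_free_def lie_bracket_def heis_connection_def by (simp add: heis_christoffel_linear(5))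
  show "metric_compatible (heis_metric :: 'n heis \<Rightarrow> _) heis_connection"
    unfolding metric_compatible_def using metric_heis_connection by blast
  show "\<forall>X Y. \<not> (smooth_map X \<and> smooth_map Y) \<longrightarrow> heis_connection X Y = (\<lambda>p. 0 :: 'n heis)"
    by (auto simp: heis_connection_def)
qed

lemma is_levi_civita_heis_unique:
  assumes "is_levi_civita heis_metric N" "is_levi_civita heis_metric M" shows "N = M"
proof (intro ext)
  fix X Y p
  have sym: "heis_metric p u v = heis_metric p v u" for p u v by (simp add: heis_metric_eq inner_commute)
  have lin: "bilinear (heis_metric p)" for p 
    using bilinear_heis_metric_explicit[of p] unfolding heis_metric_eq[symmetric, abs_def] by simp
  show "N X Y p = M X Y p"
  proof (cases "smooth_map X \<and> smooth_map Y")
    case False then show ?thesis using assms unfolding is_levi_civita_def by metis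
  next
    case True
    have "heis_metric p (N X Y p - M X Y p) w = 0" for w
      using is_levi_civita_koszul[OF assms(1) sym lin, of X Y "\<lambda>_. w" p] is_levi_civita_koszul[OF assms(2) sym lin, of X Y "\<lambda>_. w" p] True
      by (simp add: bilinear_lsub[OF lin] smooth_const)
    then show ?thesis using heis_metric_nondegenerate by (metis eq_iff_diff_eq_0)
  qed
qed

lemma levi_civita_heis: "levi_civita heis_metric = heis_connection"
  unfolding levi_civita_def using is_levi_civita_heis_connection is_levi_civita_heis_unique by blast

lemma horizontal_proj_eq: "horizontal_proj p v = v - heis_form p v *\<^sub>R heis_T p"
  unfolding horizontal_proj_def
proof (rule the_equality)
  show "v - heis_form p v *\<^sub>R heis_T p \<in> horizontal_space p \<and>
    (\<forall>u\<in>horizontal_space p. heis_metric p (v - (v - heis_form p v *\<^sub>R heis_T p)) u = 0)"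
    by (auto simp: horizontal_space_iff heis_metric_eq heis_form_alt heis_T_def)
next
  fix w assume w: "w \<in> horizontal_space p \<and> (\<forall>u\<in>horizontal_space p. heis_metric p (v - w) u = 0)"
  let ?u = "v - heis_form p v *\<^sub>R heis_T p - w"
  have u: "heis_form p ?u = 0" "heis_form p w = 0" "?u \<in> horizontal_space p"
    using w by (auto simp: horizontal_space_iff heis_form_alt heis_T_def algebra_simps add_divide_distrib diff_divide_distrib)
  then have "heis_metric p (v - w) ?u = 0" using w by blast
  then have "fst ?u \<bullet> fst ?u + fst (snd ?u) \<bullet> fst (snd ?u) = 0"
    using u(1) by (simp add: heis_metric_eq heis_T_def)
  then have "fst ?u = 0 \<and> fst (snd ?u) = 0" 
    by (metis add_nonneg_eq_0_iff inner_ge_zero inner_eq_zero_iff)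
  then have "?u = 0" using u(1) by (auto simp: prod_eq_iff heis_form_alt)
  then show "w = v - heis_form p v *\<^sub>R heis_T p" by simp
qed

end

theory Submission
  imports Defs
begin

text \<open>
  Write \<open>\<theta>\<close> for the contact form \<^const>\<open>heis_form\<close>, whose kernel is the horizontal bundle.

  On horizontal vectors the Christoffel term of the Levi-Civita connection vanishes on the
  diagonal, because every summand of \<open>\<Gamma>(u, u)\<close> carries the factor \<open>\<theta>(u)\<close>. In the global coordinates the
  geodesic equation is therefore solved by every affine curve \<open>t \<mapsto> p + t u\<close> with \<open>u\<close> horizontal at
  \<open>p\<close>; such a curve stays horizontal, as \<open>\<theta>\<close> at \<open>p + t u\<close> agrees with \<open>\<theta>\<close> at \<open>p\<close> on the vector \<open>u\<close>
  (\<open>nonholonomic_geodesic_segment\<close>). Hence polygons with horizontal edges are broken geodesics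
  (\<open>broken_geodesic_of_polygon\<close>).

  Broken geodesics are horizontal curves, so \<open>d\<^sub>c \<le> d\<^sub>H\<close>. Conversely, a horizontal curve \<open>\<gamma>\<close> is
  approximated by a horizontal polygon with the same end points that is longer by at most
  \<open>\<epsilon>\<close> (\<open>polygon_near_horizontal_curve\<close>). Sample \<open>\<gamma>\<close> at \<open>N\<close> equally spaced parameters. A chord \<open>\<Delta>\<close> of
  \<open>\<gamma>\<close> starting at \<open>\<gamma>(c)\<close> has planar part no longer than the corresponding arc, and it fails to be
  horizontal only by the vertical amount \<open>\<theta>(\<Delta>)\<close> at \<open>\<gamma>(c)\<close>, which is quadratic in the step size: \<open>\<theta>\<close>
  kills the velocity at the current point, and replacing the current point by \<open>\<gamma>(c)\<close> costs only a
  Lipschitz error (\<open>horizontal_curve_chords\<close>). Subtracting the defect from every chord gives a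
  horizontal polygon that is no longer than \<open>\<gamma>\<close> and ends vertically above or below the right point, at a
  distance \<open>E = O(1/N)\<close>. A horizontal loop over a planar square of side \<open>sqrt \<bar>E\<bar>\<close> repairs this at the
  cost \<open>4 sqrt \<bar>E\<bar>\<close> (\<open>horizontal_polygon_vertical\<close>), which tends to \<open>0\<close>.
\<close>

section \<open>Horizontal segments are geodesics\<close>

text \<open>The norm of the planar part of a vector. It is the metric length of a horizontal vector and a
  lower bound for the metric length of any vector; unlike the metric it does not depend on the
  base point.\<close>

definition horizontal_norm :: "'n::finite heis \<Rightarrow> real" where
  "horizontal_norm u = norm (fst u, fst (snd u))"

lemma horizontal_norm_nonneg: "0 \<le> horizontal_norm u"
  by (simp add: horizontal_norm_def)

lemma bounded_linear_planar: "bounded_linear (\<lambda>u::'n::finite heis. (fst u, fst (snd u)))"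
  by (intro bounded_linear_Pair bounded_linear_fst bounded_linear_compose[OF bounded_linear_fst bounded_linear_snd])

lemma heis_metric_self: "heis_metric p u u = (horizontal_norm u)\<^sup>2 + (heis_form p u)\<^sup>2"
  by (simp add: heis_metric_eq horizontal_norm_def norm_Pair power2_eq_square[of "heis_form p u"]
      power2_norm_eq_inner)

lemma horizontal_norm_le_speed: "horizontal_norm u \<le> sqrt (heis_metric p u u)"
  unfolding heis_metric_self by (rule real_le_rsqrt) simp

lemma speed_horizontal: "heis_form p u = 0 \<Longrightarrow> sqrt (heis_metric p u u) = horizontal_norm u"
  by (simp add: heis_metric_self horizontal_norm_nonneg)

lemma heis_form_add: "heis_form p (u + v) = heis_form p u + heis_form p v"
  by (simp add: heis_form_alt inner_add_left inner_add_right add_divide_distrib)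

lemma heis_form_scaleR: "heis_form p (r *\<^sub>R u) = r * heis_form p u"
  by (simp add: heis_form_alt algebra_simps)

lemma bounded_linear_heis_form: "bounded_linear (heis_form p)"
  by (simp add: linear_conv_bounded_linear[symmetric] linearI heis_form_add heis_form_scaleR)

text \<open>The base point enters \<^const>\<open>heis_form\<close> through the planar symplectic form, which vanishes on
  the pair \<open>(u, u)\<close>.\<close>

lemma heis_form_along_direction: "heis_form (p + r *\<^sub>R u) u = heis_form p u"
  by (simp add: heis_form_alt algebra_simps add_divide_distrib inner_commute)

lemma velocity_interior: "t \<in> {a<..<b} \<Longrightarrow> velocity a b \<gamma> t = vector_derivative \<gamma> (at t)"
  by (simp add: velocity_def at_within_Icc_at)

text \<open>The velocity is constant, so only the Christoffel term could contribute to the acceleration, and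
  it vanishes because the velocity is horizontal.\<close>

lemma nonholonomic_geodesic_segment:
  fixes p u :: "'n::finite heis"
  assumes "c < d" and u: "heis_form p u = 0"
    and \<gamma>: "\<And>t. t \<in> {c..d} \<Longrightarrow> \<gamma> t = p + (t - c) *\<^sub>R u"
  shows "nonholonomic_geodesic c d \<gamma>"
proof -
  have sm: "smooth_curve c d \<gamma>"
    unfolding smooth_curve_def
    by (rule exI[of _ "\<lambda>t. p + (t - c) *\<^sub>R u"])
      (auto simp: \<gamma> intro!: smooth_add smooth_scaleR smooth_diff smooth_id)
  have vel: "velocity c d \<gamma> t = u" if t: "t \<in> {c..d}" for t
  proof -
    have "((\<lambda>t. p + (t - c) *\<^sub>R u) has_vector_derivative u) (at t within {c..d})"
      by (auto intro!: derivative_eq_intros)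
    then have "(\<gamma> has_vector_derivative u) (at t within {c..d})"
      by (rule has_vector_derivative_transform[OF t, rotated]) (simp add: \<gamma>)
    then show ?thesis
      unfolding velocity_def using assms(1) t
      by (intro vector_derivative_within_closed_interval) auto
  qed
  have form: "heis_form (\<gamma> t) u = 0" if "t \<in> {c..d}" for t
    using that u by (simp add: \<gamma> heis_form_along_direction)
  have cont: "continuous_on {c..d} \<gamma>"
    by (rule continuous_on_eq[of _ "\<lambda>t. p + (t - c) *\<^sub>R u"]) (auto simp: \<gamma> intro!: continuous_intros)
  have "piecewise (\<lambda>c d. smooth_curve c d \<gamma>) c d"
    unfolding piecewise_def
    by (rule exI[of _ 1], rule exI[of _ "\<lambda>i. if i = 0 then c else d"]) (use sm assms(1) in auto)
  then have hor: "horizontal_curve c d \<gamma>"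
    unfolding horizontal_curve_def piecewise_smooth_curve_def
    using assms(1) cont vel form by (auto intro!: AE_I2 simp: horizontal_space_iff)
  have "covariant_derivative_along (levi_civita heis_metric) c d \<gamma> (velocity c d \<gamma>) t = 0"
    if t: "t \<in> {c..d}" for t
  proof -
    have "((\<lambda>t. u) has_vector_derivative 0) (at t within {c..d})"
      by (rule has_vector_derivative_const)
    then have "(velocity c d \<gamma> has_vector_derivative 0) (at t within {c..d})"
      by (rule has_vector_derivative_transform[OF t, rotated]) (simp add: vel)
    then have "vector_derivative (velocity c d \<gamma>) (at t within {c..d}) = 0"
      using assms(1) t by (intro vector_derivative_within_closed_interval) auto
    moreover have "heis_christoffel (\<gamma> t) u u = 0"
      using form[OF t] by (simp add: heis_christoffel_def Let_def zero_prod_def)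
    ultimately show ?thesis
      by (simp add: covariant_derivative_along_def levi_civita_heis heis_connection_def
          smooth_const lie_derivative_def vel[OF t] frechet_derivative_const)
  qed
  then show ?thesis
    unfolding nonholonomic_geodesic_def using sm hor
    by (simp add: horizontal_proj_eq heis_form_alt)
qed

section \<open>Horizontal polygons\<close>

text \<open>Polygons are described by their edges alone: without a parametrisation, concatenation needs no
  gluing of curves. The parametrisation is supplied once, for the finished polygon.\<close>

inductive horizontal_polygon :: "'n::finite heis \<Rightarrow> 'n heis \<Rightarrow> real \<Rightarrow> bool" for p where
  start: "horizontal_polygon p p 0"
| edge: "horizontal_polygon p q L \<Longrightarrow> heis_form q u = 0 \<Longrightarrow>
    horizontal_polygon p (q + u) (L + horizontal_norm u)"

lemma horizontal_polygon_vertices: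
  assumes "horizontal_polygon p q L"
  obtains m P where "0 < m" "P 0 = p" "P m = q" "\<And>i. i < m \<Longrightarrow> heis_form (P i) (P (Suc i) - P i) = 0"
    "L = (\<Sum>i<m. horizontal_norm (P (Suc i) - P i))"
proof -
  have "\<exists>m P. 0 < m \<and> P 0 = p \<and> P m = q \<and> (\<forall>i<m. heis_form (P i) (P (Suc i) - P i) = 0) \<and>
    L = (\<Sum>i<m. horizontal_norm (P (Suc i) - P i))"
    using assms
  proof induction
    case start
    \<comment> \<open>A curve needs a parameter interval of positive length, so the empty polygon becomes a
      single degenerate edge.\<close>
    show ?case
      by (rule exI[of _ 1], rule exI[of _ "\<lambda>_. p"]) (simp add: heis_form_alt horizontal_norm_def)
  next
    case (edge q L u)
    then obtain m P where P: "0 < m" "P 0 = p" "P m = q"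
      "\<forall>i<m. heis_form (P i) (P (Suc i) - P i) = 0"
      "L = (\<Sum>i<m. horizontal_norm (P (Suc i) - P i))"
      by blast
    let ?P = "P(Suc m := q + u)"
    have "(\<Sum>i<m. horizontal_norm (?P (Suc i) - ?P i)) = L"
      unfolding P(5) by (rule sum.cong) auto
    then have "(\<Sum>i<Suc m. horizontal_norm (?P (Suc i) - ?P i)) = L + horizontal_norm u"
      using P(3) by simp
    moreover have "\<forall>i<Suc m. heis_form (?P i) (?P (Suc i) - ?P i) = 0"
      using P edge by (auto simp: less_Suc_eq)
    ultimately show ?case
      using P by (intro exI[of _ "Suc m"] exI[of _ ?P]) auto
  qed
  with that show ?thesis by blast
qed

text \<open>Each edge is parametrised affinely on an interval \<open>[i, i + 1]\<close>. Velocities are compared only in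
  the open intervals: at the vertices the two-sided velocity may not exist, but these form a
  finite set, invisible to the length and to almost-everywhere horizontality.\<close>

lemma broken_geodesic_of_polygon:
  fixes p q :: "'n::finite heis"
  assumes "horizontal_polygon p q L"
  obtains b \<gamma> where "broken_geodesic 0 b \<gamma>" "\<gamma> 0 = p" "\<gamma> b = q" "heis_length 0 b \<gamma> = L"
proof -
  obtain m P where m: "0 < m" and ends: "P 0 = p" "P m = q"
    and hor: "\<And>i. i < m \<Longrightarrow> heis_form (P i) (P (Suc i) - P i) = 0"
    and L: "L = (\<Sum>i<m. horizontal_norm (P (Suc i) - P i))"
    by (rule horizontal_polygon_vertices[OF assms]) (rule that)
  define u where "u i = P (Suc i) - P i" for i
  define \<gamma> where "\<gamma> t = P (nat \<lfloor>t\<rfloor>) + (t - real (nat \<lfloor>t\<rfloor>)) *\<^sub>R u (nat \<lfloor>t\<rfloor>)" for t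
  have node: "\<gamma> (real i) = P i" for i
    by (simp add: \<gamma>_def)
  have piece: "\<gamma> t = P i + (t - real i) *\<^sub>R u i" if "t \<in> {real i..real (Suc i)}" for i t
  proof (cases "t = real (Suc i)")
    case True
    show ?thesis unfolding True node by (simp add: u_def)
  next
    case False
    then have "nat \<lfloor>t\<rfloor> = i" using that by (simp add: nat_eq_iff floor_eq_iff)
    then show ?thesis by (simp add: \<gamma>_def)
  qed
  have geo: "nonholonomic_geodesic (real i) (real (Suc i)) \<gamma>" if "i < m" for i
    using hor[OF that] piece by (intro nonholonomic_geodesic_segment[of _ _ "P i" "u i"]) (auto simp: u_def)
  have pieces: "piecewise Q 0 (real m)"
    if "\<And>i. i < m \<Longrightarrow> Q (real i) (real (Suc i))" for Q
    unfolding piecewise_def by (rule exI[of _ m], rule exI[of _ real]) (use that in auto)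
  have cont: "continuous_on {0..real k} \<gamma>" for k
  proof (induction k)
    case (Suc k)
    have "continuous_on {real k..real (Suc k)} \<gamma>"
      by (rule continuous_on_eq[of _ "\<lambda>t. P k + (t - real k) *\<^sub>R u k"])
        (auto simp: piece intro!: continuous_intros)
    then have "continuous_on ({0..real k} \<union> {real k..real (Suc k)}) \<gamma>"
      using Suc by (intro continuous_on_closed_Un) auto
    moreover have "{0..real k} \<union> {real k..real (Suc k)} = {0..real (Suc k)}" by auto
    ultimately show ?case by simp
  qed simp
  have deriv: "velocity 0 (real m) \<gamma> t = u i" if t: "t \<in> {real i<..<real (Suc i)}" and "i < m" for t i
  proof -
    have "((\<lambda>t. P i + (t - real i) *\<^sub>R u i) has_vector_derivative u i) (at t)"
      by (auto intro!: derivative_eq_intros)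
    then have "(\<gamma> has_vector_derivative u i) (at t)"
      by (rule has_vector_derivative_transform_within_open[OF _ _ t]) (auto intro!: piece[symmetric])
    moreover have "t \<in> {0<..<real m}" using that by auto
    ultimately show ?thesis by (simp add: velocity_interior vector_derivative_at)
  qed
  have form: "heis_form (\<gamma> t) (u i) = 0" if "t \<in> {real i<..<real (Suc i)}" "i < m" for t i
  proof -
    have "\<gamma> t = P i + (t - real i) *\<^sub>R u i" using that by (intro piece) auto
    then show ?thesis using hor[OF that(2)] by (simp add: heis_form_along_direction u_def)
  qed
  have "AE t in lebesgue_on {0..real m}. velocity 0 (real m) \<gamma> t \<in> horizontal_space (\<gamma> t)"
  proof (rule AE_I'[of "real ` {..m}"])
    show "real ` {..m} \<in> null_sets (lebesgue_on {0..real m})"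
      by (auto simp: null_sets_restrict_space negligible_iff_null_sets[symmetric])
    show "{t \<in> space (lebesgue_on {0..real m}). velocity 0 (real m) \<gamma> t \<notin> horizontal_space (\<gamma> t)}
      \<subseteq> real ` {..m}"
    proof (rule subsetI, rule ccontr)
      fix t assume t: "t \<in> {t \<in> space (lebesgue_on {0..real m}). velocity 0 (real m) \<gamma> t \<notin> horizontal_space (\<gamma> t)}"
        and n: "t \<notin> real ` {..m}"
      let ?i = "nat \<lfloor>t\<rfloor>"
      have t0: "0 \<le> t" "t \<le> real m" using t by auto
      then have i: "real ?i \<le> t" "t < real (Suc ?i)" by linarith+
      moreover have "?i \<le> m" using i t0 by linarith
      moreover have "t \<noteq> real ?i" "t \<noteq> real m" using n \<open>?i \<le> m\<close> by blast+
      ultimately have "real ?i < t" "t < real m" using t0 by linarith+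
      then have "t \<in> {real ?i<..<real (Suc ?i)}" "?i < m" using i by (simp_all del: of_nat_nat)
      then show False using t deriv form by (auto simp: horizontal_space_iff)
    qed
  qed
  moreover have "piecewise_smooth_curve 0 (real m) \<gamma>"
    unfolding piecewise_smooth_curve_def
  proof (intro conjI)
    show "piecewise (\<lambda>c d. smooth_curve c d \<gamma>) 0 (real m)"
      by (rule pieces) (use geo in \<open>simp add: nonholonomic_geodesic_def\<close>)
  qed (use m cont in auto)
  moreover have "piecewise (\<lambda>c d. nonholonomic_geodesic c d \<gamma>) 0 (real m)"
    by (rule pieces) (rule geo)
  ultimately have "broken_geodesic 0 (real m) \<gamma>"
    unfolding broken_geodesic_def horizontal_curve_def by simp
  moreover have "heis_length 0 (real m) \<gamma> = L"
  proof -
    let ?f = "\<lambda>t. sqrt (heis_metric (\<gamma> t) (velocity 0 (real m) \<gamma> t) (velocity 0 (real m) \<gamma> t))"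
    have "(?f has_integral (\<Sum>i<k. horizontal_norm (u i))) {0..real k}" if "k \<le> m" for k
      using that
    proof (induction k)
      case (Suc k)
      have const: "((\<lambda>t. horizontal_norm (u k)) has_integral horizontal_norm (u k)) {real k..real (Suc k)}"
        using has_integral_const_real[of "horizontal_norm (u k)" "real k" "real (Suc k)"] by simp
      have on: "?f t = horizontal_norm (u k)" if "t \<in> {real k..real (Suc k)} - {real k, real (Suc k)}" for t
      proof -
        have t: "t \<in> {real k<..<real (Suc k)}" and k: "k < m"
          using that Suc.prems by auto
        show ?thesis
          unfolding deriv[OF t k] by (rule speed_horizontal[OF form[OF t k]])
      qed
      have piece_length: "(?f has_integral horizontal_norm (u k)) {real k..real (Suc k)}"
        by (rule has_integral_spike_finite[where S = "{real k, real (Suc k)}", OF _ on const]) auto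
      have "(?f has_integral (\<Sum>i<k. horizontal_norm (u i))) {0..real k}"
        using Suc by simp
      from has_integral_combine[OF _ _ this piece_length] show ?case
        by simp
    qed (simp add: has_integral_refl(2)[of _ "0::real", simplified])
    from this[of m] show ?thesis
      unfolding heis_length_def L by (simp add: integral_unique u_def)
  qed
  ultimately show ?thesis using that[of "real m" \<gamma>] ends node[of 0] node[of m] by simp
qed

text \<open>Going around a planar rectangle with sides \<open>a\<close> and \<open>b\<close> in the plane of a conjugate pair
  \<open>(x\<^sub>j, y\<^sub>j)\<close> changes the vertical coordinate by its signed area \<open>- a b\<close>; this is the bracket
  relation \<open>[X\<^sub>j, Y\<^sub>j] = - T\<close> in integrated form. A square of area \<open>\<bar>\<delta>\<bar>\<close> has perimeter
  \<open>4 sqrt \<bar>\<delta>\<bar>\<close>.\<close>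

lemma horizontal_polygon_vertical:
  fixes p q :: "'n::finite heis"
  assumes "horizontal_polygon p q L"
  shows "horizontal_polygon p (q + \<delta> *\<^sub>R heis_T q) (L + 4 * sqrt \<bar>\<delta>\<bar>)"
proof -
  obtain x y t where q: "q = (x, y, t)" by (cases q) auto
  obtain j :: 'n where True by blast
  define a where "a = sqrt \<bar>\<delta>\<bar>"
  define b where "b = - sgn \<delta> * a"
  have ab: "a * b = - \<delta>" and na: "\<bar>a\<bar> = a" "\<bar>b\<bar> = a"
    by (auto simp: a_def b_def abs_mult sgn_if abs_if)
  \<comment> \<open>Horizontal edges in the directions \<open>X\<^sub>j\<close> and \<open>Y\<^sub>j\<close>; \<open>s\<close> is the value of the other coordinate along
    the edge.\<close>
  let ?x = "\<lambda>r s. (r *\<^sub>R axis j 1, 0, r * s / 2) :: 'n heis" and ?y = "\<lambda>r s. (0, r *\<^sub>R axis j 1, - r * s / 2) :: 'n heis"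
  have n: "horizontal_norm (?x r s) = \<bar>r\<bar>" "horizontal_norm (?y r s) = \<bar>r\<bar>" for r s
    by (auto simp: horizontal_norm_def norm_Pair norm_axis_1)
  have "horizontal_polygon p ((((q + ?x a (y $ j)) + ?y b (x $ j + a)) + ?x (- a) (y $ j + b)) + ?y (- b) (x $ j))
    ((((L + horizontal_norm (?x a (y $ j))) + horizontal_norm (?y b (x $ j + a)))
       + horizontal_norm (?x (- a) (y $ j + b))) + horizontal_norm (?y (- b) (x $ j)))"
    by (intro horizontal_polygon.edge assms)
      (auto simp: q heis_form_alt inner_axis inner_axis' axis_nth_real field_simps)
  then have "horizontal_polygon p ((((q + ?x a (y $ j)) + ?y b (x $ j + a)) + ?x (- a) (y $ j + b)) + ?y (- b) (x $ j))
      (L + \<bar>a\<bar> + \<bar>b\<bar> + \<bar>- a\<bar> + \<bar>- b\<bar>)"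
    unfolding n .
  also have "((((q + ?x a (y $ j)) + ?y b (x $ j + a)) + ?x (- a) (y $ j + b)) + ?y (- b) (x $ j)) = q + (- (a * b)) *\<^sub>R heis_T q"
    by (simp add: q heis_T_def field_simps)
  also have "L + \<bar>a\<bar> + \<bar>b\<bar> + \<bar>- a\<bar> + \<bar>- b\<bar> = L + 4 * a"
    using na by simp
  finally show ?thesis unfolding ab by (simp add: a_def)
qed

section \<open>Sampling a horizontal curve\<close>

lemma piecewise_chain:
  assumes "piecewise Q a b" "a < b" and Q: "\<And>c d. c < d \<Longrightarrow> Q c d \<Longrightarrow> R c d"
    and trans: "\<And>c d e. c < d \<Longrightarrow> d < e \<Longrightarrow> R c d \<Longrightarrow> R d e \<Longrightarrow> R c e"
  shows "R a b"
proof -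
  obtain m s where s: "s 0 = a" "s m = b" "\<And>i. i < m \<Longrightarrow> s i < s (Suc i) \<and> Q (s i) (s (Suc i))"
    using assms(1) unfolding piecewise_def by blast
  have "k \<noteq> 0 \<longrightarrow> a < s k \<and> R a (s k)" if "k \<le> m" for k
    using that
  proof (induction k)
    case (Suc k)
    then have k: "s k < s (Suc k)" "R (s k) (s (Suc k))" using s(3)[of k] Q by auto
    show ?case
    proof (cases "k = 0")
      case True
      then show ?thesis using k s(1) by simp
    next
      case False
      then have "a < s k" "R a (s k)" using Suc by auto
      then show ?thesis using k trans[of a "s k" "s (Suc k)"] by simp
    qed
  qed simp
  from this[of m] s assms(2) show ?thesis by (cases m) auto
qed

text \<open>The two-sided derivative makes the speed independent of the parameter interval, so that lengths
  of consecutive arcs can be added.\<close>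

abbreviation speed :: "(real \<Rightarrow> 'n::finite heis) \<Rightarrow> real \<Rightarrow> real" where
  "speed \<gamma> t \<equiv> sqrt (heis_metric (\<gamma> t) (vector_derivative \<gamma> (at t)) (vector_derivative \<gamma> (at t)))"

lemma smooth_map_vector_derivative:
  fixes c :: "real \<Rightarrow> 'a::euclidean_space"
  assumes "smooth_map c"
  shows "(c has_vector_derivative frechet_derivative c (at t) 1) (at t)"
proof -
  have D: "(c has_derivative frechet_derivative c (at t)) (at t)"
    by (rule smooth_differentiable[OF assms])
  have "frechet_derivative c (at t) x = x *\<^sub>R frechet_derivative c (at t) 1" for x
    using linear_cmul[OF has_derivative_linear[OF D], of x 1] by simp
  then have "frechet_derivative c (at t) = (\<lambda>x. x *\<^sub>R frechet_derivative c (at t) 1)" ..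
  with D show ?thesis unfolding has_vector_derivative_def by metis
qed

lemma smooth_map_continuous_on: "smooth_map f \<Longrightarrow> continuous_on S f"
  unfolding smooth_map_def by (metis Ck.simps(1) continuous_on_subset subset_UNIV)

text \<open>On each piece the velocity extends continuously to the closed interval, which gives both the
  bound and integrability; the exceptional set consists of the break points.\<close>

lemma piecewise_smooth_curve_derivative:
  fixes \<gamma> :: "real \<Rightarrow> 'n::finite heis"
  assumes "piecewise_smooth_curve a b \<gamma>"
  obtains F M where "finite F" "0 \<le> M"
    "\<And>t. t \<in> {a..b} - F \<Longrightarrow> (\<gamma> has_vector_derivative vector_derivative \<gamma> (at t)) (at t)"
    "\<And>t. t \<in> {a..b} - F \<Longrightarrow> norm (vector_derivative \<gamma> (at t)) \<le> M"
    "speed \<gamma> integrable_on {a..b}"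
proof -
  let ?d = "\<lambda>t. vector_derivative \<gamma> (at t)"
  let ?R = "\<lambda>a b. (\<exists>F M. finite F \<and> 0 \<le> M \<and>
      (\<forall>t\<in>{a..b} - F. (\<gamma> has_vector_derivative ?d t) (at t) \<and> norm (?d t) \<le> M)) \<and>
      speed \<gamma> integrable_on {a..b}"
  have "?R a b"
  proof (rule piecewise_chain[of "\<lambda>c d. smooth_curve c d \<gamma>" a b ?R])
    show "piecewise (\<lambda>c d. smooth_curve c d \<gamma>) a b" "a < b"
      using assms by (auto simp: piecewise_smooth_curve_def)
  next
    fix c d :: real assume "c < d" "smooth_curve c d \<gamma>"
    then obtain f where f: "smooth_map f" and eq: "\<And>t. t \<in> {c..d} \<Longrightarrow> \<gamma> t = f t"
      by (auto simp: smooth_curve_def)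
    let ?f' = "\<lambda>t. frechet_derivative f (at t) 1"
    have der: "(\<gamma> has_vector_derivative ?f' t) (at t)" if "t \<in> {c<..<d}" for t
      by (rule has_vector_derivative_transform_within_open[OF smooth_map_vector_derivative[OF f] _ that])
        (auto simp: eq)
    then have der': "?d t = ?f' t" if "t \<in> {c<..<d}" for t
      using that by (simp add: vector_derivative_at)
    have cont: "continuous_on {c..d} ?f'" "continuous_on {c..d} f"
      using f by (auto intro: smooth_map_continuous_on smooth_dir)
    have "bounded (?f' ` {c..d})"
      using compact_continuous_image[OF cont(1)] compact_imp_bounded by blast
    then obtain M where M: "0 < M" "\<forall>t\<in>{c..d}. norm (?f' t) \<le> M"
      unfolding bounded_pos by auto
    have "(\<lambda>t. sqrt (heis_metric (f t) (?f' t) (?f' t))) integrable_on {c..d}"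
      unfolding heis_metric_eq heis_form_alt
      by (intro integrable_continuous_interval continuous_intros cont) auto
    then have "speed \<gamma> integrable_on {c..d}"
      by (rule integrable_spike_finite[of "{c, d}", rotated 2]) (auto simp: der' eq)
    then show "?R c d"
      using der der' M by (auto intro!: exI[of _ "{c, d}"] exI[of _ M])
  next
    fix c d e :: real assume "c < d" "d < e" "?R c d" "?R d e"
    then obtain F M F' M' where "finite F" "0 \<le> M" "finite F'" "0 \<le> M'"
      "\<forall>t\<in>{c..d} - F. (\<gamma> has_vector_derivative ?d t) (at t) \<and> norm (?d t) \<le> M"
      "\<forall>t\<in>{d..e} - F'. (\<gamma> has_vector_derivative ?d t) (at t) \<and> norm (?d t) \<le> M'"
      by blast
    then have bd: "\<forall>t\<in>{c..e} - (F \<union> F'). (\<gamma> has_vector_derivative ?d t) (at t) \<and> norm (?d t) \<le> max M M'"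
      by (metis Diff_iff Un_iff atLeastAtMost_iff le_max_iff_disj linear)
    have "speed \<gamma> integrable_on {c..e}"
      using \<open>c < d\<close> \<open>d < e\<close> \<open>?R c d\<close> \<open>?R d e\<close>
      by (meson Henstock_Kurzweil_Integration.integrable_combine less_imp_le)
    moreover have "finite (F \<union> F')" "0 \<le> max M M'"
      using \<open>finite F\<close> \<open>finite F'\<close> \<open>0 \<le> M\<close> by auto
    ultimately show "?R c e"
      using bd by (intro conjI exI[of _ "F \<union> F'"] exI[of _ "max M M'"])
  qed
  then obtain F M where F: "finite F" "0 \<le> M"
      "\<And>t. t \<in> {a..b} - F \<Longrightarrow> (\<gamma> has_vector_derivative ?d t) (at t) \<and> norm (?d t) \<le> M"
    and int: "speed \<gamma> integrable_on {a..b}"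
    by blast
  show ?thesis
    by (rule that[OF F(1,2) _ _ int]) (use F(3) in auto)
qed

lemma heis_form_base_change:
  "\<bar>heis_form p u - heis_form q u\<bar> \<le> norm (q - p) * norm u"
proof -
  have e: "heis_form p u - heis_form q u =
      (fst u \<bullet> fst (snd (q - p))) / 2 - (fst (q - p) \<bullet> fst (snd u)) / 2"
    by (simp add: heis_form_alt algebra_simps diff_divide_distrib)
  have c: "norm (fst v) \<le> norm v" "norm (fst (snd v)) \<le> norm v" for v :: "'a heis"
    by (metis norm_fst_le norm_snd_le order_trans prod.collapse)+
  have "\<bar>fst u \<bullet> fst (snd (q - p))\<bar> \<le> norm u * norm (q - p)"
    by (rule order_trans[OF Cauchy_Schwarz_ineq2]) (intro mult_mono c norm_ge_zero)
  moreover have "\<bar>fst (q - p) \<bullet> fst (snd u)\<bar> \<le> norm (q - p) * norm u"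
    by (rule order_trans[OF Cauchy_Schwarz_ineq2]) (intro mult_mono c norm_ge_zero)
  ultimately show ?thesis unfolding e by (simp add: mult.commute)
qed

lemma has_integral_bound_spike_negligible:
  fixes f :: "real \<Rightarrow> real"
  assumes "0 \<le> B" "negligible S" "(f has_integral i) {c..d}" "c \<le> d"
    and "\<And>x. x \<in> {c..d} - S \<Longrightarrow> \<bar>f x\<bar> \<le> B"
  shows "\<bar>i\<bar> \<le> B * (d - c)"
proof -
  have "((\<lambda>x. if x \<in> S then 0 else f x) has_integral i) {c..d}"
    by (rule has_integral_spike[OF assms(2) _ assms(3)]) auto
  from has_integral_bound_spike_finite[OF assms(1) finite.emptyI this[unfolded box_real(2)[symmetric]]]
  show ?thesis using assms by auto
qed

text \<open>Both estimates integrate the velocity over \<open>[c, d]\<close>. For the first, the norm of an integral is at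
  most the integral of the norm. For the second, the contact form at \<open>\<gamma> c\<close> of the velocity at \<open>t\<close>
  differs from the contact form at \<open>\<gamma> t\<close>, which is \<open>0\<close>, by at most \<open>norm (\<gamma> t - \<gamma> c)\<close> times the
  norm of the velocity; as \<open>\<gamma>\<close> is Lipschitz, this product is of order \<open>d - c\<close>.\<close>

lemma horizontal_curve_chords:
  fixes \<gamma> :: "real \<Rightarrow> 'n::finite heis"
  assumes "horizontal_curve a b \<gamma>"
  obtains K where "0 \<le> K" "speed \<gamma> integrable_on {a..b}"
    "\<And>c d. a \<le> c \<Longrightarrow> c \<le> d \<Longrightarrow> d \<le> b \<Longrightarrow> horizontal_norm (\<gamma> d - \<gamma> c) \<le> integral {c..d} (speed \<gamma>)"
    "\<And>c d. a \<le> c \<Longrightarrow> c \<le> d \<Longrightarrow> d \<le> b \<Longrightarrow> \<bar>heis_form (\<gamma> c) (\<gamma> d - \<gamma> c)\<bar> \<le> K * (d - c)\<^sup>2"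
proof -
  let ?d = "\<lambda>t. vector_derivative \<gamma> (at t)"
  have pw: "piecewise_smooth_curve a b \<gamma>"
    and ae: "AE t in lebesgue_on {a..b}. velocity a b \<gamma> t \<in> horizontal_space (\<gamma> t)"
    using assms by (auto simp: horizontal_curve_def)
  obtain F M where F: "finite F" and M0: "0 \<le> M"
    and D: "\<And>t. t \<in> {a..b} - F \<Longrightarrow> (\<gamma> has_vector_derivative ?d t) (at t)"
    and M: "\<And>t. t \<in> {a..b} - F \<Longrightarrow> norm (?d t) \<le> M"
    and int: "speed \<gamma> integrable_on {a..b}"
    by (rule piecewise_smooth_curve_derivative[OF pw]) (rule that)
  have cont: "continuous_on {a..b} \<gamma>" using pw by (simp add: piecewise_smooth_curve_def)
  obtain N where N: "negligible N" "\<And>t. t \<in> {a..b} - N \<Longrightarrow> velocity a b \<gamma> t \<in> horizontal_space (\<gamma> t)"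
  proof -
    obtain N where "N \<in> null_sets (lebesgue_on {a..b})"
      "{t \<in> space (lebesgue_on {a..b}). velocity a b \<gamma> t \<notin> horizontal_space (\<gamma> t)} \<subseteq> N"
      using ae unfolding eventually_ae_filter by blast
    then show ?thesis
      using that[of N] by (auto simp: null_sets_restrict_space negligible_iff_null_sets)
  qed
  define N' where "N' = N \<union> F \<union> {a, b}"
  have N': "negligible N'" unfolding N'_def using N(1) F by (intro negligible_Un) (auto intro: negligible_finite)
  have hor: "heis_form (\<gamma> t) (?d t) = 0" if "t \<in> {a..b} - N'" for t
    using N(2)[of t] that by (auto simp: N'_def horizontal_space_iff velocity_interior)
  have ftc: "(?d has_integral \<gamma> d - \<gamma> c) {c..d}" if "a \<le> c" "c \<le> d" "d \<le> b" for c d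
    by (rule fundamental_theorem_of_calculus_interior_strong[OF F])
      (use that D in \<open>auto intro: continuous_on_subset[OF cont]\<close>)
  have lip: "norm (\<gamma> d - \<gamma> c) \<le> M * (d - c)" if "a \<le> c" "c \<le> d" "d \<le> b" for c d
    using has_integral_bound_spike_finite[OF M0 F, of ?d "\<gamma> d - \<gamma> c" c d] ftc[OF that] M that by auto
  show ?thesis
  proof (rule that[of "M\<^sup>2"])
    fix c d assume cd: "a \<le> c" "c \<le> d" "d \<le> b"
    have planar: "((\<lambda>t. (fst (?d t), fst (snd (?d t)))) has_integral (fst (\<gamma> d - \<gamma> c), fst (snd (\<gamma> d - \<gamma> c)))) {c..d}"
      using has_integral_linear[OF ftc[OF cd] bounded_linear_planar] by (simp add: o_def)
    have "speed \<gamma> integrable_on {c..d}"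
      using int cd by (auto intro: integrable_subinterval_real)
    from integral_norm_bound_integral[OF has_integral_integrable[OF planar] this horizontal_norm_le_speed[unfolded horizontal_norm_def]]
    have "norm (fst (\<gamma> d - \<gamma> c), fst (snd (\<gamma> d - \<gamma> c))) \<le> integral {c..d} (speed \<gamma>)"
      unfolding integral_unique[OF planar] .
    then show "horizontal_norm (\<gamma> d - \<gamma> c) \<le> integral {c..d} (speed \<gamma>)"
      unfolding horizontal_norm_def .
    have "((\<lambda>t. heis_form (\<gamma> c) (?d t)) has_integral heis_form (\<gamma> c) (\<gamma> d - \<gamma> c)) {c..d}"
      using has_integral_linear[OF ftc[OF cd] bounded_linear_heis_form] by (simp add: o_def)
    moreover have "\<bar>heis_form (\<gamma> c) (?d t)\<bar> \<le> M\<^sup>2 * (d - c)" if t: "t \<in> {c..d} - N'" for t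
    proof -
      have "\<bar>heis_form (\<gamma> c) (?d t)\<bar> \<le> norm (\<gamma> t - \<gamma> c) * norm (?d t)"
        using heis_form_base_change[of "\<gamma> c" "?d t" "\<gamma> t"] hor[of t] t cd by auto
      also have "\<dots> \<le> (M * (d - c)) * M"
      proof (rule mult_mono)
        have "norm (\<gamma> t - \<gamma> c) \<le> M * (t - c)" using lip[of c t] t cd by auto
        also have "\<dots> \<le> M * (d - c)" using t M0 by (intro mult_left_mono) auto
        finally show "norm (\<gamma> t - \<gamma> c) \<le> M * (d - c)" .
      qed (use M[of t] M0 t cd in \<open>auto simp: N'_def\<close>)
      finally show ?thesis by (simp add: power2_eq_square algebra_simps)
    qed
    ultimately have "\<bar>heis_form (\<gamma> c) (\<gamma> d - \<gamma> c)\<bar> \<le> M\<^sup>2 * (d - c) * (d - c)"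
      using has_integral_bound_spike_negligible[OF _ N', of "M\<^sup>2 * (d - c)"] cd by auto
    then show "\<bar>heis_form (\<gamma> c) (\<gamma> d - \<gamma> c)\<bar> \<le> M\<^sup>2 * (d - c)\<^sup>2"
      by (simp add: power2_eq_square algebra_simps)
  qed (use int in auto)
qed

lemma heis_length_eq_speed: "heis_length a b \<gamma> = integral {a..b} (speed \<gamma>)"
  unfolding heis_length_def
  by (rule integral_spike[of "{a, b}"]) (auto simp: velocity_interior)

lemma heis_form_vertical_shift: "heis_form (p + r *\<^sub>R heis_T p') u = heis_form p u"
  by (simp add: heis_form_alt heis_T_def)

text \<open>The polygon follows the planar projection of the curve exactly through the sample points, so that
  its vertices are the sample points shifted vertically. The shifts do not change which vectors are
  horizontal, hence the defects of the chords simply add up: \<open>N\<close> defects of size \<open>O(1/N\<^sup>2)\<close>.\<close>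

lemma polygon_near_horizontal_curve:
  fixes \<gamma> :: "real \<Rightarrow> 'n::finite heis"
  assumes "horizontal_curve a b \<gamma>" "0 < \<epsilon>"
  obtains L where "horizontal_polygon (\<gamma> a) (\<gamma> b) L" "L \<le> heis_length a b \<gamma> + \<epsilon>"
proof -
  have ab: "a < b" using assms(1) by (simp add: horizontal_curve_def piecewise_smooth_curve_def)
  obtain K where K: "0 \<le> K" and int: "speed \<gamma> integrable_on {a..b}"
    and len: "\<And>c d. a \<le> c \<Longrightarrow> c \<le> d \<Longrightarrow> d \<le> b \<Longrightarrow> horizontal_norm (\<gamma> d - \<gamma> c) \<le> integral {c..d} (speed \<gamma>)"
    and err: "\<And>c d. a \<le> c \<Longrightarrow> c \<le> d \<Longrightarrow> d \<le> b \<Longrightarrow> \<bar>heis_form (\<gamma> c) (\<gamma> d - \<gamma> c)\<bar> \<le> K * (d - c)\<^sup>2"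
    by (rule horizontal_curve_chords[OF assms(1)]) (rule that)
  define C where "C = K * (b - a)\<^sup>2"
  \<comment> \<open>\<open>C / N\<close> bounds the accumulated vertical defect; closing it costs \<open>4 sqrt (C / N) \<le> \<epsilon>\<close>.\<close>
  obtain N :: nat where N: "0 < N" "C / real N \<le> (\<epsilon> / 4)\<^sup>2"
  proof -
    obtain N :: nat where N: "C / (\<epsilon> / 4)\<^sup>2 < real N" using reals_Archimedean2 by blast
    have "0 \<le> C / (\<epsilon> / 4)\<^sup>2" using K by (simp add: C_def)
    with N have "0 < real N" by linarith
    moreover from this N have "C / real N \<le> (\<epsilon> / 4)\<^sup>2" using assms(2) by (simp add: field_simps)
    ultimately show ?thesis using that[of N] by simp
  qed
  define h where "h = (b - a) / real N"
  have h: "0 < h" "real N * h = b - a" using ab N by (auto simp: h_def)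
  define s where "s i = a + real i * h" for i
  have s: "a \<le> s i" "s i \<le> s (Suc i)" "s (Suc i) - s i = h" for i
    using h by (auto simp: s_def algebra_simps)
  have sN: "s i \<le> b" if "i \<le> N" for i
  proof -
    have "real i * h \<le> real N * h" using that h by (intro mult_right_mono) auto
    then show ?thesis using h by (simp add: s_def)
  qed
  have step: "\<exists>L E. horizontal_polygon (\<gamma> a) (\<gamma> (s i) + E *\<^sub>R heis_T (\<gamma> a)) L \<and>
      L \<le> integral {a..s i} (speed \<gamma>) \<and> \<bar>E\<bar> \<le> real i * (K * h\<^sup>2)" if "i \<le> N" for i
    using that
  proof (induction i)
    case 0
    show ?case
      by (rule exI[of _ 0], rule exI[of _ 0]) (auto simp: s_def horizontal_polygon.start)
  next
    case (Suc i)
    then obtain L E where IH: "horizontal_polygon (\<gamma> a) (\<gamma> (s i) + E *\<^sub>R heis_T (\<gamma> a)) L"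
      "L \<le> integral {a..s i} (speed \<gamma>)" "\<bar>E\<bar> \<le> real i * (K * h\<^sup>2)"
      by auto
    define \<Delta> where "\<Delta> = \<gamma> (s (Suc i)) - \<gamma> (s i)"
    define e where "e = heis_form (\<gamma> (s i)) \<Delta>"
    have bnd: "s (Suc i) \<le> b" using sN Suc.prems by blast
    let ?u = "\<Delta> - e *\<^sub>R heis_T (\<gamma> a)"
    have flat: "heis_form (\<gamma> (s i) + E *\<^sub>R heis_T (\<gamma> a)) ?u = 0"
      unfolding heis_form_vertical_shift by (simp add: e_def heis_form_alt heis_T_def)
    have "\<gamma> (s i) + E *\<^sub>R heis_T (\<gamma> a) + ?u = \<gamma> (s (Suc i)) + (E - e) *\<^sub>R heis_T (\<gamma> a)"
      by (simp add: \<Delta>_def scaleR_diff_left)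
    moreover have "horizontal_norm ?u = horizontal_norm \<Delta>"
      by (simp add: horizontal_norm_def heis_T_def)
    ultimately have "horizontal_polygon (\<gamma> a) (\<gamma> (s (Suc i)) + (E - e) *\<^sub>R heis_T (\<gamma> a)) (L + horizontal_norm \<Delta>)"
      using horizontal_polygon.edge[OF IH(1) flat] by simp
    moreover have "L + horizontal_norm \<Delta> \<le> integral {a..s (Suc i)} (speed \<gamma>)"
    proof -
      have "integral {a..s i} (speed \<gamma>) + integral {s i..s (Suc i)} (speed \<gamma>) = integral {a..s (Suc i)} (speed \<gamma>)"
        by (rule Henstock_Kurzweil_Integration.integral_combine) (use s bnd in \<open>auto intro: integrable_subinterval_real[OF int]\<close>)
      then show ?thesis using IH(2) len[OF s(1,2) bnd] by (simp add: \<Delta>_def)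
    qed
    moreover have "\<bar>E - e\<bar> \<le> real (Suc i) * (K * h\<^sup>2)"
      using IH(3) err[OF s(1,2) bnd] unfolding s(3) \<Delta>_def[symmetric] e_def[symmetric]
      by (simp add: algebra_simps)
    ultimately show ?case by blast
  qed
  have sb: "s N = b" using h by (simp add: s_def)
  obtain L E where L: "horizontal_polygon (\<gamma> a) (\<gamma> b + E *\<^sub>R heis_T (\<gamma> a)) L"
    "L \<le> heis_length a b \<gamma>" "\<bar>E\<bar> \<le> real N * (K * h\<^sup>2)"
    using step[of N] unfolding sb heis_length_eq_speed by auto
  have "real N * (K * h\<^sup>2) = C / real N"
    using N by (simp add: h_def C_def power2_eq_square field_simps)
  then have "\<bar>E\<bar> \<le> (\<epsilon> / 4)\<^sup>2" using L(3) N(2) by simp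
  then have "sqrt \<bar>E\<bar> \<le> \<epsilon> / 4" using assms(2) by (intro real_le_lsqrt) auto
  moreover have "heis_T (\<gamma> b + E *\<^sub>R heis_T (\<gamma> a)) = heis_T (\<gamma> a)"
    by (simp add: heis_T_def)
  then have "horizontal_polygon (\<gamma> a) (\<gamma> b) (L + 4 * sqrt \<bar>E\<bar>)"
    using horizontal_polygon_vertical[OF L(1), of "- E"] by simp
  ultimately show ?thesis using that L(2) by force
qed

theorem proposition3p17:
  fixes p q :: "'n::finite heis"
  shows "heis_dc p q = heis_dH p q"
proof (rule antisym)
  show "heis_dc p q \<le> heis_dH p q"
    unfolding heis_dc_def heis_dH_def
    by (rule Inf_superset_mono) (auto simp: broken_geodesic_def)
  show "heis_dH p q \<le> heis_dc p q"
    unfolding heis_dc_def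
  proof (rule Inf_greatest)
    fix l assume "l \<in> {ereal (heis_length a b \<gamma>) | a b \<gamma>. horizontal_curve a b \<gamma> \<and> \<gamma> a = p \<and> \<gamma> b = q}"
    then obtain a b \<gamma> where l: "l = ereal (heis_length a b \<gamma>)"
      and \<gamma>: "horizontal_curve a b \<gamma>" "\<gamma> a = p" "\<gamma> b = q" by blast
    show "heis_dH p q \<le> l"
    proof (rule ereal_le_epsilon2)
      fix \<epsilon> :: real assume "0 < \<epsilon>"
      then obtain L where L: "horizontal_polygon p q L" "L \<le> heis_length a b \<gamma> + \<epsilon>"
        using polygon_near_horizontal_curve[OF \<gamma>(1)] \<gamma>(2,3) by metis
      obtain b' \<gamma>' where "broken_geodesic 0 b' \<gamma>'" "\<gamma>' 0 = p" "\<gamma>' b' = q" "heis_length 0 b' \<gamma>' = L"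
        using broken_geodesic_of_polygon[OF L(1)] by blast
      then have "heis_dH p q \<le> ereal L"
        unfolding heis_dH_def by (intro Inf_lower) blast
      also have "\<dots> \<le> l + ereal \<epsilon>" using L(2) by (simp add: l)
      finally show "heis_dH p q \<le> l + ereal \<epsilon>" .
    qed
  qed
qed

end
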